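(* Let $\mathscr T=(V,E)$ be a rooted directed tree with root $\mathsf{root}$. For $u,b\in V$, consider a weight system $\lambda_u=\{\lambda_{uv}\}$ of complex numbers and let $W_{f,g}$ be the rank one extension of the weighted join operator $W^{(b)}_{\lambda_u}$ on $\mathscr T$, where $f\in\ell^2(V)\ominus\mathscr H$ is non-zero and $g:U\to\mathbb C$ is given ($U$, $\mathscr H=\ell^2(U)$, $D$, $W_{f,g}$ and compatibility conditions are defined in the context). Suppose that $W_{f,g}$ satisfies a compatibility condition. Then $W_{f,g}$ defines a closed linear operator with domain given by $$\mathscr D(W_{f,g})=\{(h,k):h\in\mathscr D(D),\ k\in\ell^2(V)\ominus\mathscr H\}.$$ Moreover, $\mathscr D_V=\mathrm{span}\{e_v:v\in V\}$ forms a core for $W_{f,g}$.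
   Context: Trees. A directed tree $\mathscr T=(V,E)$ is a directed graph (no loops, $V$ and $E$ nonempty) which has no circuits, is connected (ignoring orientation), and in which every non-root vertex $v$ has exactly one parent $\mathsf{par}(v)$; it is rooted if there is a unique vertex $\mathsf{root}$ without parent. Throughout $\mathrm{card}(V)=\aleph_0$. $\mathsf{Des}(u)$ is the set of descendants of $u$, including $u$; $\mathsf{Asc}(u)=\{\mathsf{par}^{\langle n\rangle}(u):n\ge1\}$; for $v\in\mathsf{Des}(u)$, $[u,v]$ is the set of vertices of the directed path from $u$ to $v$ and $\mathsf{Des}_v(u)=\mathsf{Des}(u)\setminus[u,v]$. Rank one extension. Let $u,b\in V$ and $\{\lambda_{uv}\}_{v\in V}\subseteq\mathbb C$. Put $U=V\setminus\{u\}$ if $b=u$; $U=\mathsf{Asc}(u)\cup\mathsf{Des}_b(u)$ if $b\in\mathsf{Des}(u)\setminus\{u\}$; $U=\mathsf{Des}(u)\setminus\{u\}$ if $b\notin\mathsf{Des}(u)$. Put $A_u=[u,b]$ if $b\in\mathsf{Des}(u)$ and $A_u=\mathsf{Asc}(u)\cup\{b,u\}$ otherwise. $\mathscr H=\mathscr H^{(b)}_u=\ell^2(U)\subseteq\ell^2(V)$. $D=D^{(b)}_{\lambda_u}$ is the maximally defined diagonal operator in $\mathscr H$ with $De_v=\lambda_{uv}e_v$ ($v\in U$), and $N=N^{(b)}_{\lambda_u}=e_u\otimes e_{\lambda_u,A_u}$ on $\ell^2(V)\ominus\mathscr H$, with $e_{\lambda_u,A_u}=\sum_{v\in A_u}\overline{\lambda_{uv}}e_v$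 and $(x\otimes y)h=\langle h,y\rangle x$. (The weighted join operator is $W^{(b)}_{\lambda_u}=D\oplus N$.) The operator $f\oslash g$ has domain $\{h\in\mathscr H:\sum_{v\in U}h(v)\overline{g(v)}\text{ is convergent}\}$ and $(f\oslash g)h=\big(\sum_{v\in U}h(v)\overline{g(v)}\big)f$. $W_{f,g}$ is the operator in $\ell^2(V)$ with domain $\{(h,k):h\in\mathscr D(D)\cap\mathscr D(f\oslash g),\ k\in\ell^2(V)\ominus\mathscr H\}$ and $W_{f,g}=\begin{bmatrix}D&0\\ f\oslash g&N\end{bmatrix}$. Compatibility. $\Gamma_{\lambda_u}=\{\mu\in\mathbb C:\inf_{v\in U}|\mu-\lambda_{uv}|>0\}$. Compatibility condition I: there is $\mu_0\in\Gamma_{\lambda_u}$ with $\sum_{v\in U}\frac{|g(v)|^2}{|\lambda_{uv}-\mu_0|^2}<\infty$. Compatibility condition II: $\sum_{v\in U}\frac{|g(v)|^2}{|\lambda_{uv}|^2+1}<\infty$. "Satisfies a compatibility condition" means that I or II holds. A dense subspace $\mathscr D\subseteq\mathscr D(T)$ is a core of a closable operator $T$ if $\overline{T|_{\mathscr D}}=\overline T$. *)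

theory Defs
  imports "HOL-Analysis.Analysis"
begin

section \<open>Square-summable families\<close>

typedef 'v ell2 = "{x :: 'v \<Rightarrow> complex. (\<lambda>v. (cmod (x v))\<^sup>2) summable_on UNIV}"
  morphisms coord Abs_ell2
  by (intro exI[of _ "\<lambda>_. 0"]) simp

setup_lifting type_definition_ell2

lemma coord_square_summable: "(\<lambda>v. (cmod (coord x v))\<^sup>2) summable_on UNIV"
  using coord by auto

lemma square_summable_add:
  fixes x y :: "'v \<Rightarrow> complex"
  assumes "(\<lambda>v. (cmod (x v))\<^sup>2) summable_on UNIV" "(\<lambda>v. (cmod (y v))\<^sup>2) summable_on UNIV"
  shows "(\<lambda>v. (cmod (x v + y v))\<^sup>2) summable_on UNIV"
proof (rule summable_on_comparison_test)
  show "(\<lambda>v. 2 * ((cmod (x v))\<^sup>2 + (cmod (y v))\<^sup>2)) summable_on UNIV"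
    by (intro summable_on_cmult_right summable_on_add assms)
  fix v
  have "(cmod (x v + y v))\<^sup>2 \<le> (cmod (x v) + cmod (y v))\<^sup>2"
    by (intro power_mono norm_triangle_ineq) auto
  also have "\<dots> \<le> 2 * ((cmod (x v))\<^sup>2 + (cmod (y v))\<^sup>2)"
    using zero_le_power2[of "cmod (x v) - cmod (y v)"]
    by (simp add: power2_eq_square algebra_simps)
  finally show "(cmod (x v + y v))\<^sup>2 \<le> 2 * ((cmod (x v))\<^sup>2 + (cmod (y v))\<^sup>2)" .
qed auto

lemma square_summable_scale:
  fixes x :: "'v \<Rightarrow> complex"
  assumes "(\<lambda>v. (cmod (x v))\<^sup>2) summable_on UNIV"
  shows "(\<lambda>v. (cmod (c * x v))\<^sup>2) summable_on UNIV"
  using summable_on_cmult_right[OF assms, of "(cmod c)\<^sup>2"]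
  by (simp add: norm_mult power_mult_distrib)

lemma product_summable:
  fixes x y :: "'v \<Rightarrow> complex"
  assumes "(\<lambda>v. (cmod (x v))\<^sup>2) summable_on UNIV" "(\<lambda>v. (cmod (y v))\<^sup>2) summable_on UNIV"
  shows "(\<lambda>v. x v * cnj (y v)) summable_on UNIV"
proof (rule abs_summable_summable, rule summable_on_comparison_test)
  show "(\<lambda>v. (cmod (x v))\<^sup>2 + (cmod (y v))\<^sup>2) summable_on UNIV"
    by (intro summable_on_add assms)
  fix v
  have "2 * (cmod (x v) * cmod (y v)) \<le> (cmod (x v))\<^sup>2 + (cmod (y v))\<^sup>2"
    using zero_le_power2[of "cmod (x v) - cmod (y v)"]
    by (simp add: power2_eq_square algebra_simps)
  moreover have "0 \<le> cmod (x v) * cmod (y v)"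
    by simp
  ultimately show "norm (x v * cnj (y v)) \<le> (cmod (x v))\<^sup>2 + (cmod (y v))\<^sup>2"
    unfolding norm_mult complex_mod_cnj by linarith
qed auto

lift_definition scaleC :: "complex \<Rightarrow> 'v ell2 \<Rightarrow> 'v ell2" is "\<lambda>c x v. c * x v"
  by (rule square_summable_scale)

lift_definition cinner :: "'v ell2 \<Rightarrow> 'v ell2 \<Rightarrow> complex"
  is "\<lambda>x y. \<Sum>\<^sub>\<infinity>v. x v * cnj (y v)" .

instantiation ell2 :: (type) real_vector
begin

lift_definition zero_ell2 :: "'a ell2" is "\<lambda>_. 0" by simp
lift_definition plus_ell2 :: "'a ell2 \<Rightarrow> 'a ell2 \<Rightarrow> 'a ell2" is "\<lambda>x y v. x v + y v"
  by (rule square_summable_add)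
lift_definition uminus_ell2 :: "'a ell2 \<Rightarrow> 'a ell2" is "\<lambda>x v. - x v" by simp
lift_definition minus_ell2 :: "'a ell2 \<Rightarrow> 'a ell2 \<Rightarrow> 'a ell2" is "\<lambda>x y v. x v - y v"
  subgoal for x y using square_summable_add[of x "\<lambda>v. - y v"] by simp
  done
definition scaleR_ell2 :: "real \<Rightarrow> 'a ell2 \<Rightarrow> 'a ell2" where
  "scaleR_ell2 r = scaleC (of_real r)"

instance
  by standard (unfold scaleR_ell2_def, (transfer, auto simp: algebra_simps)+)

end

instantiation ell2 :: (type) real_inner
begin

definition inner_ell2 :: "'a ell2 \<Rightarrow> 'a ell2 \<Rightarrow> real" where
  "inner_ell2 x y = Re (cinner x y)"
definition norm_ell2 :: "'a ell2 \<Rightarrow> real" where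
  "norm_ell2 x = sqrt (inner x x)"
definition sgn_ell2 :: "'a ell2 \<Rightarrow> 'a ell2" where
  "sgn_ell2 x = x /\<^sub>R norm x"
definition dist_ell2 :: "'a ell2 \<Rightarrow> 'a ell2 \<Rightarrow> real" where
  "dist_ell2 x y = norm (x - y)"
definition uniformity_ell2 :: "('a ell2 \<times> 'a ell2) filter" where
  "uniformity_ell2 = (INF e\<in>{0<..}. principal {(x, y). dist x y < e})"
definition open_ell2 :: "'a ell2 set \<Rightarrow> bool" where
  "open_ell2 S \<longleftrightarrow> (\<forall>x\<in>S. eventually (\<lambda>(x', y). x' = x \<longrightarrow> y \<in> S) uniformity)"

instance
proof
  fix x y z :: "'a ell2" and r :: real
  have summ: "(\<lambda>v. coord a v * cnj (coord b v)) summable_on UNIV" for a b :: "'a ell2"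
    by (intro product_summable coord_square_summable)
  have Re_inner: "inner a b = (\<Sum>\<^sub>\<infinity>v. Re (coord a v * cnj (coord b v)))" for a b :: "'a ell2"
    unfolding inner_ell2_def cinner.rep_eq by (rule infsum_Re[OF summ, symmetric])
  have Re_summ: "(\<lambda>v. Re (coord a v * cnj (coord b v))) summable_on UNIV" for a b :: "'a ell2"
    by (rule summable_on_Re[OF summ])
  have Re_self: "Re (coord a v * cnj (coord a v)) = (cmod (coord a v))\<^sup>2" for a :: "'a ell2" and v
    by (metis complex_norm_square Re_complex_of_real)
  show "dist x y = norm (x - y)" by (rule dist_ell2_def)
  show "sgn x = x /\<^sub>R norm x" by (rule sgn_ell2_def)
  show "uniformity = (INF e\<in>{0<..}. principal {(x :: 'a ell2, y). dist x y < e})"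
    by (rule uniformity_ell2_def)
  show "open S \<longleftrightarrow> (\<forall>x\<in>S. eventually (\<lambda>(x', y). x' = x \<longrightarrow> y \<in> S) uniformity)"
    for S :: "'a ell2 set"
    by (rule open_ell2_def)
  show "norm x = sqrt (inner x x)" by (rule norm_ell2_def)
  show "inner x y = inner y x"
    unfolding Re_inner by (simp add: mult.commute)
  show "inner (x + y) z = inner x z + inner y z"
    unfolding Re_inner
    by (subst infsum_add[symmetric, OF Re_summ Re_summ])
       (simp add: plus_ell2.rep_eq algebra_simps)
  show "inner (r *\<^sub>R x) y = r * inner x y"
    unfolding Re_inner
    by (subst infsum_cmult_right[symmetric, OF Re_summ])
       (simp add: scaleR_ell2_def scaleC.rep_eq algebra_simps)
  show "0 \<le> inner x x"
    unfolding Re_inner Re_self by (rule infsum_nonneg) auto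
  show "inner x x = 0 \<longleftrightarrow> x = 0"
  proof
    assume "inner x x = 0"
    hence "(cmod (coord x v))\<^sup>2 = 0" for v
      unfolding Re_inner Re_self
      by (intro nonneg_infsum_le_0D[of _ UNIV]) (auto simp: coord_square_summable)
    thus "x = 0"
      by (intro coord_inject[THEN iffD1] ext) (simp add: zero_ell2.rep_eq)
  qed (simp add: Re_inner zero_ell2.rep_eq)
qed

end

interpretation ell2: vector_space scaleC
  by standard (transfer, auto simp: algebra_simps)+

lift_definition ket :: "'v \<Rightarrow> 'v ell2" is "\<lambda>v w. of_bool (w = v)"
  subgoal for v
    by (rule finite_nonzero_values_imp_summable_on, rule finite_subset[of _ "{v}"]) auto
  done

lift_definition restrict_ell2 :: "'v set \<Rightarrow> 'v ell2 \<Rightarrow> 'v ell2" is "\<lambda>A x v. if v \<in> A then x v else 0"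
  subgoal for A x
    by (rule summable_on_comparison_test[of "\<lambda>v. (cmod (x v))\<^sup>2"]) auto
  done

text \<open>\<open>ell2_on A\<close> is \<open>\<ell>\<^sup>2(A)\<close>, embedded by extending families by zero. It is a closed
  subspace, so closures and closedness may be taken in the ambient type.\<close>

definition ell2_on :: "'v set \<Rightarrow> 'v ell2 set" where
  "ell2_on A = {x. \<forall>v. v \<notin> A \<longrightarrow> coord x v = 0}"

definition ominus :: "'v ell2 set \<Rightarrow> 'v ell2 set \<Rightarrow> 'v ell2 set" (infixl "\<ominus>" 65) where
  "X \<ominus> Y = {x \<in> X. \<forall>y\<in>Y. cinner x y = 0}"

section \<open>Unbounded operators\<close>

text \<open>The values of \<open>op_app T\<close> outside \<open>op_dom T\<close> carry no meaning; operators are compared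
  through their graphs.\<close>

record 'v operator =
  op_dom :: "'v ell2 set"
  op_app :: "'v ell2 \<Rightarrow> 'v ell2"

definition op_graph :: "'v operator \<Rightarrow> ('v ell2 \<times> 'v ell2) set" where
  "op_graph T = {(x, op_app T x) | x. x \<in> op_dom T}"

definition op_restrict :: "'v operator \<Rightarrow> 'v ell2 set \<Rightarrow> 'v operator" where
  "op_restrict T \<D> = \<lparr>op_dom = op_dom T \<inter> \<D>, op_app = op_app T\<rparr>"

definition linear_operator_in :: "'v ell2 set \<Rightarrow> 'v operator \<Rightarrow> bool" where
  "linear_operator_in H T \<longleftrightarrow>
     ell2.subspace (op_dom T) \<and> op_dom T \<subseteq> H \<and> op_app T ` op_dom T \<subseteq> H \<and>
     (\<forall>x\<in>op_dom T. \<forall>y\<in>op_dom T. op_app T (x + y) = op_app T x + op_app T y) \<and>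
     (\<forall>c. \<forall>x\<in>op_dom T. op_app T (scaleC c x) = scaleC c (op_app T x))"

definition closed_operator :: "'v operator \<Rightarrow> bool" where
  "closed_operator T \<longleftrightarrow> closed (op_graph T)"

definition closable_operator :: "'v operator \<Rightarrow> bool" where
  "closable_operator T \<longleftrightarrow> single_valued (closure (op_graph T))"

definition is_core :: "'v ell2 set \<Rightarrow> 'v ell2 set \<Rightarrow> 'v operator \<Rightarrow> bool" where
  "is_core H \<D> T \<longleftrightarrow>
     closable_operator T \<and>
     ell2.subspace \<D> \<and> \<D> \<subseteq> op_dom T \<and> closure \<D> = H \<and>
     closure (op_graph (op_restrict T \<D>)) = closure (op_graph T)"

section \<open>Directed trees\<close>

definition circuit :: "('v \<times> 'v) set \<Rightarrow> 'v list \<Rightarrow> bool" where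
  "circuit E p \<longleftrightarrow> length p \<ge> 2 \<and> distinct p \<and>
     successively (\<lambda>x y. (x, y) \<in> E) p \<and> (last p, hd p) \<in> E"

definition has_parent :: "('v \<times> 'v) set \<Rightarrow> 'v \<Rightarrow> bool" where
  "has_parent E v \<longleftrightarrow> (\<exists>w. (w, v) \<in> E)"

definition directed_tree :: "'v set \<Rightarrow> ('v \<times> 'v) set \<Rightarrow> bool" where
  "directed_tree V E \<longleftrightarrow>
     V \<noteq> {} \<and> E \<noteq> {} \<and> E \<subseteq> V \<times> V \<and> (\<forall>v. (v, v) \<notin> E) \<and>
     (\<nexists>p. circuit E p) \<and>
     (\<forall>x\<in>V. \<forall>y\<in>V. (x, y) \<in> (E \<union> E\<inverse>)\<^sup>*) \<and>
     (\<forall>v\<in>V. has_parent E v \<longrightarrow> (\<exists>!w. (w, v) \<in> E))"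

definition rooted_directed_tree :: "'v set \<Rightarrow> ('v \<times> 'v) set \<Rightarrow> 'v \<Rightarrow> bool" where
  "rooted_directed_tree V E r \<longleftrightarrow>
     directed_tree V E \<and> r \<in> V \<and> (\<forall>v\<in>V. \<not> has_parent E v \<longleftrightarrow> v = r)"

definition Des :: "('v \<times> 'v) set \<Rightarrow> 'v \<Rightarrow> 'v set" where
  "Des E u = {v. (u, v) \<in> E\<^sup>*}"

text \<open>In a directed tree, \<open>(w, u) \<in> E ^^ n\<close> says that the \<open>n\<close>-th parent of \<open>u\<close> exists and
  is \<open>w\<close>.\<close>

definition Asc :: "('v \<times> 'v) set \<Rightarrow> 'v \<Rightarrow> 'v set" where
  "Asc E u = {w. \<exists>n\<ge>1. (w, u) \<in> E ^^ n}"

definition dipath :: "('v \<times> 'v) set \<Rightarrow> 'v \<Rightarrow> 'v list \<Rightarrow> 'v \<Rightarrow> bool" where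
  "dipath E u p v \<longleftrightarrow> p \<noteq> [] \<and> hd p = u \<and> last p = v \<and> distinct p \<and>
     successively (\<lambda>x y. (x, y) \<in> E) p"

text \<open>In a directed tree there is exactly one directed path from \<open>u\<close> to \<open>v \<in> Des E u\<close>.\<close>

definition path_verts :: "('v \<times> 'v) set \<Rightarrow> 'v \<Rightarrow> 'v \<Rightarrow> 'v set" where
  "path_verts E u v = {w. \<exists>p. dipath E u p v \<and> w \<in> set p}"

section \<open>Rank one extensions of weighted join operators\<close>

definition join_U :: "'v set \<Rightarrow> ('v \<times> 'v) set \<Rightarrow> 'v \<Rightarrow> 'v \<Rightarrow> 'v set" where
  "join_U V E u b =
     (if b = u then V - {u}
      else if b \<in> Des E u then Asc E u \<union> (Des E u - path_verts E u b)
      else Des E u - {u})"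

definition join_A :: "('v \<times> 'v) set \<Rightarrow> 'v \<Rightarrow> 'v \<Rightarrow> 'v set" where
  "join_A E u b = (if b \<in> Des E u then path_verts E u b else Asc E u \<union> {b, u})"

definition diag_op :: "'v set \<Rightarrow> ('v \<Rightarrow> complex) \<Rightarrow> 'v operator" where
  "diag_op U lam =
     \<lparr>op_dom = {h \<in> ell2_on U. (\<lambda>v. (cmod (lam v * coord h v))\<^sup>2) summable_on U},
      op_app = (\<lambda>h. Abs_ell2 (\<lambda>v. if v \<in> U then lam v * coord h v else 0))\<rparr>"

text \<open>In a rooted tree every vertex has finitely many ascendants, so \<open>join_A E u b\<close> is finite
  and the sum below is a genuine finite sum.\<close>

definition e_weight :: "('v \<Rightarrow> complex) \<Rightarrow> 'v set \<Rightarrow> 'v ell2" where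
  "e_weight lam A = (\<Sum>v\<in>A. scaleC (cnj (lam v)) (ket v))"

definition rank_one :: "'v ell2 \<Rightarrow> 'v ell2 \<Rightarrow> 'v ell2 \<Rightarrow> 'v ell2" where
  "rank_one x y h = scaleC (cinner h y) x"

definition join_N :: "('v \<times> 'v) set \<Rightarrow> 'v \<Rightarrow> 'v \<Rightarrow> ('v \<Rightarrow> complex) \<Rightarrow> 'v ell2 \<Rightarrow> 'v ell2" where
  "join_N E u b lam = rank_one (ket u) (e_weight lam (join_A E u b))"

text \<open>Only the values of \<open>g\<close> on \<open>U\<close> matter. Sums over the (unordered) index set \<open>U\<close> are
  unconditional.\<close>

definition oslash_op :: "'v set \<Rightarrow> 'v ell2 \<Rightarrow> ('v \<Rightarrow> complex) \<Rightarrow> 'v operator" where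
  "oslash_op U f g =
     \<lparr>op_dom = {h \<in> ell2_on U. (\<lambda>v. coord h v * cnj (g v)) summable_on U},
      op_app = (\<lambda>h. scaleC (\<Sum>\<^sub>\<infinity>v\<in>U. coord h v * cnj (g v)) f)\<rparr>"

text \<open>The pair \<open>(h, k)\<close> is identified with \<open>h + k\<close>, so for \<open>x = h + k\<close> one recovers \<open>h\<close> as
  \<open>restrict_ell2 U x\<close>.\<close>

definition rank_one_ext ::
  "'v set \<Rightarrow> ('v \<times> 'v) set \<Rightarrow> 'v \<Rightarrow> 'v \<Rightarrow> ('v \<Rightarrow> complex) \<Rightarrow> 'v ell2 \<Rightarrow> ('v \<Rightarrow> complex) \<Rightarrow>
   'v operator" where
  "rank_one_ext V E u b lam f g =
     (let U = join_U V E u b; D = diag_op U lam; F = oslash_op U f g in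
      \<lparr>op_dom = {h + k | h k. h \<in> op_dom D \<inter> op_dom F \<and> k \<in> ell2_on V \<ominus> ell2_on U},
       op_app = (\<lambda>x. let h = restrict_ell2 U x; k = x - h in
                   op_app D h + (op_app F h + join_N E u b lam k))\<rparr>)"

text \<open>The infimum is taken in the extended reals so that it is \<open>\<infinity>\<close> when \<open>U = {}\<close>.\<close>

definition Gamma_set :: "'v set \<Rightarrow> ('v \<Rightarrow> complex) \<Rightarrow> complex set" where
  "Gamma_set U lam = {\<mu>. (INF v\<in>U. ereal (cmod (\<mu> - lam v))) > 0}"

definition compat_I :: "'v set \<Rightarrow> ('v \<Rightarrow> complex) \<Rightarrow> ('v \<Rightarrow> complex) \<Rightarrow> bool" where
  "compat_I U lam g \<longleftrightarrow>
     (\<exists>\<mu>\<in>Gamma_set U lam. (\<lambda>v. (cmod (g v))\<^sup>2 / (cmod (lam v - \<mu>))\<^sup>2) summable_on U)"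

definition compat_II :: "'v set \<Rightarrow> ('v \<Rightarrow> complex) \<Rightarrow> ('v \<Rightarrow> complex) \<Rightarrow> bool" where
  "compat_II U lam g \<longleftrightarrow>
     (\<lambda>v. (cmod (g v))\<^sup>2 / ((cmod (lam v))\<^sup>2 + 1)) summable_on U"

end

theory Submission
  imports Defs
begin

text \<open>
  Write \<open>P\<close> for the projection onto \<open>\<ell>\<^sup>2(U)\<close> and \<open>L = D P\<close> for the diagonal part, so that
  \<open>W x = L x + c(P x) f + N (x - P x)\<close> with the functional \<open>c(h) = (\<Sum>v\<in>U. h v * cnj (g v))\<close>
  and a bounded \<open>N\<close>.

  The point is that \<open>c\<close> is bounded relative to \<open>D\<close>. The first compatibility condition implies
  the second (\<open>compat_I_imp_compat_II\<close>), and under the second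
  \<open>c(h) = \<langle>h, p\<rangle> + \<langle>D h, q\<rangle>\<close> with square-summable \<open>p = g / (1 + \<bar>lam\<bar>\<^sup>2)\<close> and \<open>q = lam * p\<close>
  (\<open>compat_II_functional\<close>). Thus \<open>c\<close> is defined on the whole domain of \<open>D\<close>, which gives the
  domain of \<open>W\<close>, and \<open>W x\<close> is a continuous function of the pair \<open>(x, L x)\<close>.

  Closedness and the core property both follow from this continuity
  (\<open>relatively_bounded_closed_core\<close>). If \<open>x\<^sub>n\<close> and \<open>W x\<^sub>n\<close> converge, then so does
  \<open>L x\<^sub>n = P (W x\<^sub>n - N (x\<^sub>n - P x\<^sub>n))\<close>, because \<open>f\<close> is orthogonal to \<open>\<ell>\<^sup>2(U)\<close>; since \<open>L\<close> is
  closed, the limit of \<open>x\<^sub>n\<close> lies in the domain and \<open>W x\<^sub>n\<close> converges to its image. For the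
  core, the truncations of \<open>x\<close> to finite sets of vertices lie in the span of the basis vectors
  and converge to \<open>x\<close>; \<open>L\<close> commutes with truncation, so their images under \<open>L\<close>, and hence
  under \<open>W\<close>, converge as well.
\<close>

section \<open>Coordinates, norms and truncations\<close>

lemmas coord_simps [simp] =
  zero_ell2.rep_eq plus_ell2.rep_eq minus_ell2.rep_eq uminus_ell2.rep_eq
  scaleC.rep_eq ket.rep_eq restrict_ell2.rep_eq

lemma ell2_eqI: "(\<And>v. coord x v = coord y v) \<Longrightarrow> x = y"
  by (metis coord_inject ext)

lemma coord_sum [simp]: "coord (sum f A) v = (\<Sum>i\<in>A. coord (f i) v)"
  by (induction A rule: infinite_finite_induct) auto

lemma coord_Abs_ell2:
  assumes "(\<lambda>v. (cmod (x v))\<^sup>2) summable_on U"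
  shows "coord (Abs_ell2 (\<lambda>v. if v \<in> U then x v else 0)) v = (if v \<in> U then x v else 0)"
proof -
  have "(\<lambda>v. (cmod (if v \<in> U then x v else 0))\<^sup>2) summable_on UNIV"
    using assms by (subst summable_on_cong_neutral[where T = U and g = "\<lambda>v. (cmod (x v))\<^sup>2"]) auto
  then show ?thesis by (subst Abs_ell2_inverse) auto
qed

lemma norm_ell2_sq: "(norm x)\<^sup>2 = (\<Sum>\<^sub>\<infinity>v. (cmod (coord x v))\<^sup>2)"
proof -
  have "(norm x)\<^sup>2 = Re (cinner x x)"
    by (simp add: power2_norm_eq_inner inner_ell2_def)
  also have "\<dots> = (\<Sum>\<^sub>\<infinity>v. Re (coord x v * cnj (coord x v)))"
    unfolding cinner.rep_eq
    by (intro infsum_Re[symmetric] product_summable coord_square_summable)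
  also have "\<dots> = (\<Sum>\<^sub>\<infinity>v. (cmod (coord x v))\<^sup>2)"
    by (intro infsum_cong) (metis complex_norm_square Re_complex_of_real)
  finally show ?thesis .
qed

lemma norm_restrict_Pythagoras:
  "(norm x)\<^sup>2 = (norm (restrict_ell2 A x))\<^sup>2 + (norm (x - restrict_ell2 A x))\<^sup>2"
proof -
  let ?y = "restrict_ell2 A x"
  have "(cmod (coord x v))\<^sup>2 = (cmod (coord ?y v))\<^sup>2 + (cmod (coord (x - ?y) v))\<^sup>2" for v
    by simp
  then show ?thesis
    unfolding norm_ell2_sq
    by (simp add: infsum_add[OF coord_square_summable coord_square_summable] del: coord_simps)
qed

lemma norm_restrict_le: "norm (restrict_ell2 A x) \<le> norm x"
proof (rule power2_le_imp_le)
  show "(norm (restrict_ell2 A x))\<^sup>2 \<le> (norm x)\<^sup>2"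
    unfolding norm_restrict_Pythagoras[of x A] by (rule le_add_same_cancel1[THEN iffD2]) simp
qed simp

lemma restrict_add: "restrict_ell2 A (x + y) = restrict_ell2 A x + restrict_ell2 A y"
  by (rule ell2_eqI) auto

lemma restrict_scaleC: "restrict_ell2 A (scaleC c x) = scaleC c (restrict_ell2 A x)"
  by (rule ell2_eqI) auto

lemma restrict_diff: "restrict_ell2 A (x - y) = restrict_ell2 A x - restrict_ell2 A y"
  by (rule ell2_eqI) auto

lemma tendsto_restrict [tendsto_intros]:
  assumes "(X \<longlongrightarrow> x) F"
  shows "((\<lambda>n. restrict_ell2 A (X n)) \<longlongrightarrow> restrict_ell2 A x) F"
proof (rule metric_tendsto_imp_tendsto[OF assms])
  show "\<forall>\<^sub>F n in F. dist (restrict_ell2 A (X n)) (restrict_ell2 A x) \<le> dist (X n) x"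
    by (simp add: dist_norm restrict_diff[symmetric] norm_restrict_le)
qed

lemma norm_coord_le: "cmod (coord x v) \<le> norm x"
proof (rule power2_le_imp_le)
  have "(cmod (coord x v))\<^sup>2 = (\<Sum>w\<in>{v}. (cmod (coord x w))\<^sup>2)" by simp
  also have "\<dots> \<le> (norm x)\<^sup>2"
    unfolding norm_ell2_sq
    by (intro finite_sum_le_infsum coord_square_summable) auto
  finally show "(cmod (coord x v))\<^sup>2 \<le> (norm x)\<^sup>2" .
qed auto

lemma tendsto_coord [tendsto_intros]:
  assumes "(X \<longlongrightarrow> x) F"
  shows "((\<lambda>n. coord (X n) v) \<longlongrightarrow> coord x v) F"
proof (rule metric_tendsto_imp_tendsto[OF assms])
  show "\<forall>\<^sub>F n in F. dist (coord (X n) v) (coord x v) \<le> dist (X n) x"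
    using norm_coord_le[of "X _ - x" v] by (simp add: dist_norm)
qed

text \<open>By Pythagoras the squared error of a finite truncation is the tail of the convergent
  sum for \<open>(norm x)\<^sup>2\<close>.\<close>

lemma tendsto_truncation:
  "((\<lambda>F. restrict_ell2 F x) \<longlongrightarrow> x) (finite_subsets_at_top UNIV)"
proof -
  let ?s = "\<lambda>v. (cmod (coord x v))\<^sup>2"
  have fin: "(norm (restrict_ell2 F x))\<^sup>2 = sum ?s F" if "finite F" for F
  proof -
    have "(norm (restrict_ell2 F x))\<^sup>2 = infsum ?s F"
      unfolding norm_ell2_sq by (rule infsum_cong_neutral) auto
    then show ?thesis using that by simp
  qed
  have "((\<lambda>F. sqrt ((norm x)\<^sup>2 - sum ?s F)) \<longlongrightarrow> sqrt ((norm x)\<^sup>2 - (norm x)\<^sup>2))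
          (finite_subsets_at_top UNIV)"
    unfolding norm_ell2_sq by (intro tendsto_intros infsum_tendsto coord_square_summable)
  then have "((\<lambda>F. sqrt ((norm x)\<^sup>2 - sum ?s F)) \<longlongrightarrow> 0) (finite_subsets_at_top UNIV)"
    by simp
  moreover have "\<forall>\<^sub>F F in finite_subsets_at_top UNIV.
      sqrt ((norm x)\<^sup>2 - sum ?s F) = norm (restrict_ell2 F x - x)"
  proof (rule eventually_finite_subsets_at_top_weakI)
    fix F :: "'a set" assume "finite F"
    then show "sqrt ((norm x)\<^sup>2 - sum ?s F) = norm (restrict_ell2 F x - x)"
      using norm_restrict_Pythagoras[of x F] fin[of F] by (simp add: norm_minus_commute)
  qed
  ultimately have "((\<lambda>F. norm (restrict_ell2 F x - x)) \<longlongrightarrow> 0) (finite_subsets_at_top UNIV)"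
    by (rule Lim_transform_eventually)
  then show ?thesis
    by (simp add: tendsto_norm_zero_iff LIM_zero_iff)
qed

section \<open>Scalars and the complex inner product\<close>

lemma norm_scaleC: "norm (scaleC c x) = cmod c * norm x"
proof -
  have "(norm (scaleC c x))\<^sup>2 = (cmod c * norm x)\<^sup>2"
    unfolding norm_ell2_sq power_mult_distrib
    by (subst infsum_cmult_right[symmetric])
       (auto simp: norm_mult power_mult_distrib coord_square_summable)
  then show ?thesis by simp
qed

lemma tendsto_scaleC [tendsto_intros]:
  assumes "(c \<longlongrightarrow> c0) F"
  shows "((\<lambda>n. scaleC (c n) x) \<longlongrightarrow> scaleC c0 x) F"
proof -
  have "((\<lambda>n. cmod (c n - c0) * norm x) \<longlongrightarrow> 0) F"
    using assms by (auto intro!: tendsto_mult_left_zero tendsto_norm_zero LIM_zero)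
  then have "((\<lambda>n. norm (scaleC (c n) x - scaleC c0 x)) \<longlongrightarrow> 0) F"
    by (simp add: ell2.scale_left_diff_distrib[symmetric] norm_scaleC)
  then show ?thesis by (simp add: tendsto_norm_zero_iff LIM_zero_iff)
qed

lemma product_summable_coord: "(\<lambda>v. coord x v * cnj (coord y v)) summable_on UNIV"
  by (intro product_summable coord_square_summable)

lemma cinner_add: "cinner (x + y) z = cinner x z + cinner y z"
  unfolding cinner.rep_eq
  by (subst infsum_add[symmetric, OF product_summable_coord product_summable_coord])
     (simp add: algebra_simps)

lemma cinner_scaleC: "cinner (scaleC c x) z = c * cinner x z"
  unfolding cinner.rep_eq
  by (subst infsum_cmult_right[symmetric, OF product_summable_coord])
     (simp add: algebra_simps)

lemma cinner_diff: "cinner (x - y) z = cinner x z - cinner y z"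
  using cinner_add[of "x - y" y z] by simp

lemma cinner_ket: "cinner x (ket v) = coord x v"
proof -
  have "cinner x (ket v) = (\<Sum>\<^sub>\<infinity>w\<in>{v}. coord x w)"
    unfolding cinner.rep_eq by (rule infsum_cong_neutral) auto
  then show ?thesis by simp
qed

text \<open>The real inner product is the real part of the complex one; rotating \<open>x\<close> so that
  its inner product with \<open>y\<close> is a nonnegative real reduces the bound to the real
  Cauchy-Schwarz inequality.\<close>

lemma cinner_Cauchy_Schwarz: "cmod (cinner x y) \<le> norm x * norm y"
proof (cases "cinner x y = 0")
  case False
  let ?c = "cinner x y"
  have "cmod ?c * cmod ?c = Re (cinner (scaleC (cnj ?c) x) y)"
    unfolding cinner_scaleC
    by (metis Re_complex_of_real complex_norm_square mult.commute power2_eq_square)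
  also have "\<dots> = inner (scaleC (cnj ?c) x) y" by (simp add: inner_ell2_def)
  also have "\<dots> \<le> norm (scaleC (cnj ?c) x) * norm y" by (rule norm_cauchy_schwarz)
  also have "\<dots> = cmod ?c * (norm x * norm y)" by (simp add: norm_scaleC)
  finally show ?thesis using False by simp
qed auto

lemma tendsto_cinner [tendsto_intros]:
  assumes "(X \<longlongrightarrow> x) F"
  shows "((\<lambda>n. cinner (X n) y) \<longlongrightarrow> cinner x y) F"
proof -
  have "((\<lambda>n. norm (X n - x) * norm y) \<longlongrightarrow> 0) F"
    using assms by (auto intro!: tendsto_mult_left_zero tendsto_norm_zero LIM_zero)
  then have "((\<lambda>n. cinner (X n) y - cinner x y) \<longlongrightarrow> 0) F"
    by (rule Lim_null_comparison[rotated]) (simp add: cinner_diff[symmetric] cinner_Cauchy_Schwarz)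
  then show ?thesis by (simp add: LIM_zero_iff)
qed

section \<open>Coordinate subspaces\<close>

lemma subspace_ell2_on: "ell2.subspace (ell2_on A)"
  by (auto simp: ell2.subspace_def ell2_on_def)

lemma closed_ell2_on: "closed (ell2_on A)"
  unfolding closed_sequential_limits
proof (intro allI impI, elim conjE)
  fix X and x :: "'a ell2"
  assume X: "\<forall>n. X n \<in> ell2_on A" and lim: "X \<longlonglongrightarrow> x"
  have "coord x v = 0" if "v \<notin> A" for v
  proof (rule LIMSEQ_unique)
    show "(\<lambda>n. coord (X n) v) \<longlonglongrightarrow> coord x v" by (intro tendsto_intros lim)
    show "(\<lambda>n. coord (X n) v) \<longlonglongrightarrow> 0" using X that by (simp add: ell2_on_def)
  qed
  then show "x \<in> ell2_on A" by (simp add: ell2_on_def)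
qed

lemma ell2_on_ominus: "ell2_on V \<ominus> ell2_on U = ell2_on (V - U)"
proof (intro set_eqI iffI)
  fix x assume x: "x \<in> ell2_on V \<ominus> ell2_on U"
  have "coord x v = 0" if "v \<in> U" for v
  proof -
    have "ket v \<in> ell2_on U" using that by (auto simp: ell2_on_def)
    then show ?thesis using x unfolding ominus_def by (auto simp: cinner_ket[symmetric])
  qed
  then show "x \<in> ell2_on (V - U)" using x by (auto simp: ell2_on_def ominus_def)
next
  fix x :: "'a ell2" assume x: "x \<in> ell2_on (V - U)"
  have "cinner x y = 0" if "y \<in> ell2_on U" for y
    unfolding cinner.rep_eq using x that by (intro infsum_0) (auto simp: ell2_on_def)
  then show "x \<in> ell2_on V \<ominus> ell2_on U" using x by (auto simp: ell2_on_def ominus_def)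
qed

lemma ket_in_ell2_on: "v \<in> A \<Longrightarrow> ket v \<in> ell2_on A"
  by (auto simp: ell2_on_def)

lemma truncation_in_span_ket:
  assumes "x \<in> ell2_on V" "finite F"
  shows "restrict_ell2 F x \<in> ell2.span (ket ` V)"
proof -
  have "restrict_ell2 F x = (\<Sum>v\<in>F. scaleC (coord x v) (ket v))"
  proof (rule ell2_eqI)
    fix w show "coord (restrict_ell2 F x) w = coord (\<Sum>v\<in>F. scaleC (coord x v) (ket v)) w"
      using assms(2) by (simp add: of_bool_def if_distrib sum.delta cong: if_cong)
  qed
  also have "\<dots> \<in> ell2.span (ket ` V)"
  proof (rule ell2.span_sum)
    fix v
    show "scaleC (coord x v) (ket v) \<in> ell2.span (ket ` V)"
    proof (cases "v \<in> V")
      case True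
      then show ?thesis by (intro ell2.span_scale ell2.span_base) auto
    next
      case False
      then show ?thesis using assms(1) by (simp add: ell2_on_def ell2.span_zero)
    qed
  qed
  finally show ?thesis .
qed

lemma closure_span_ket: "closure (ell2.span (ket ` V)) = ell2_on V"
proof
  have "ell2.span (ket ` V) \<subseteq> ell2_on V"
    by (intro ell2.span_minimal subspace_ell2_on) (auto intro: ket_in_ell2_on)
  then show "closure (ell2.span (ket ` V)) \<subseteq> ell2_on V"
    by (intro closure_minimal closed_ell2_on)
  show "ell2_on V \<subseteq> closure (ell2.span (ket ` V))"
  proof
    fix x assume x: "x \<in> ell2_on V"
    show "x \<in> closure (ell2.span (ket ` V))"
    proof (rule Lim_in_closed_set[OF closed_closure _ _ tendsto_truncation])
      show "\<forall>\<^sub>F F in finite_subsets_at_top UNIV. restrict_ell2 F x \<in> closure (ell2.span (ket ` V))"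
        using truncation_in_span_ket[OF x] closure_subset
        by (intro eventually_finite_subsets_at_top_weakI) blast
    qed simp
  qed
qed

section \<open>The diagonal part\<close>

definition diag_dom :: "'v set \<Rightarrow> ('v \<Rightarrow> complex) \<Rightarrow> 'v ell2 set" where
  "diag_dom U lam = {x. (\<lambda>v. (cmod (lam v * coord x v))\<^sup>2) summable_on U}"

text \<open>The diagonal operator composed with the orthogonal projection onto \<open>\<ell>\<^sup>2(U)\<close>, so that
  it applies to \<open>h + k\<close> without first splitting the vector.\<close>

definition diag_map :: "'v set \<Rightarrow> ('v \<Rightarrow> complex) \<Rightarrow> 'v ell2 \<Rightarrow> 'v ell2" where
  "diag_map U lam x = Abs_ell2 (\<lambda>v. if v \<in> U then lam v * coord x v else 0)"

lemma coord_diag_map: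
  "x \<in> diag_dom U lam \<Longrightarrow> coord (diag_map U lam x) v = (if v \<in> U then lam v * coord x v else 0)"
  unfolding diag_map_def diag_dom_def by (simp add: coord_Abs_ell2)

lemma diag_domI:
  assumes "\<And>v. v \<in> U \<Longrightarrow> lam v * coord x v = coord z v"
  shows "x \<in> diag_dom U lam"
proof -
  have "(\<lambda>v. (cmod (coord z v))\<^sup>2) summable_on U"
    by (rule summable_on_subset_banach[OF coord_square_summable]) auto
  then show ?thesis
    unfolding diag_dom_def using assms by (simp cong: summable_on_cong)
qed

lemma diag_map_eqI:
  assumes "\<And>v. v \<in> U \<Longrightarrow> lam v * coord x v = coord z v" "z \<in> ell2_on U"
  shows "diag_map U lam x = z"
  using assms by (intro ell2_eqI) (auto simp: coord_diag_map[OF diag_domI] ell2_on_def)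

lemma diag_map_in_ell2_on: "x \<in> diag_dom U lam \<Longrightarrow> diag_map U lam x \<in> ell2_on U"
  by (auto simp: ell2_on_def coord_diag_map)

lemma
  assumes "x \<in> diag_dom U lam" "y \<in> diag_dom U lam"
  shows add_diag_dom: "x + y \<in> diag_dom U lam"
    and diag_map_add: "diag_map U lam (x + y) = diag_map U lam x + diag_map U lam y"
proof -
  have eq: "lam v * coord (x + y) v = coord (diag_map U lam x + diag_map U lam y) v"
    if "v \<in> U" for v
    using that assms by (simp add: coord_diag_map algebra_simps)
  show "x + y \<in> diag_dom U lam" by (rule diag_domI[OF eq])
  have "diag_map U lam x + diag_map U lam y \<in> ell2_on U"
    by (intro ell2.subspace_add subspace_ell2_on diag_map_in_ell2_on assms)
  then show "diag_map U lam (x + y) = diag_map U lam x + diag_map U lam y"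
    by (intro diag_map_eqI eq)
qed

lemma
  assumes "x \<in> diag_dom U lam"
  shows scaleC_diag_dom: "scaleC c x \<in> diag_dom U lam"
    and diag_map_scaleC: "diag_map U lam (scaleC c x) = scaleC c (diag_map U lam x)"
proof -
  have eq: "lam v * coord (scaleC c x) v = coord (scaleC c (diag_map U lam x)) v"
    if "v \<in> U" for v
    using that assms by (simp add: coord_diag_map)
  show "scaleC c x \<in> diag_dom U lam" by (rule diag_domI[OF eq])
  have "scaleC c (diag_map U lam x) \<in> ell2_on U"
    by (intro ell2.subspace_scale subspace_ell2_on diag_map_in_ell2_on assms)
  then show "diag_map U lam (scaleC c x) = scaleC c (diag_map U lam x)"
    by (intro diag_map_eqI eq)
qed

lemma
  assumes "x \<in> diag_dom U lam"
  shows restrict_diag_dom: "restrict_ell2 F x \<in> diag_dom U lam"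
    and diag_map_restrict: "diag_map U lam (restrict_ell2 F x) = restrict_ell2 F (diag_map U lam x)"
proof -
  have eq: "lam v * coord (restrict_ell2 F x) v = coord (restrict_ell2 F (diag_map U lam x)) v"
    if "v \<in> U" for v
    using that assms by (simp add: coord_diag_map)
  show "restrict_ell2 F x \<in> diag_dom U lam" by (rule diag_domI[OF eq])
  have "restrict_ell2 F (diag_map U lam x) \<in> ell2_on U"
    using diag_map_in_ell2_on[OF assms] by (simp add: ell2_on_def)
  then show "diag_map U lam (restrict_ell2 F x) = restrict_ell2 F (diag_map U lam x)"
    by (intro diag_map_eqI eq)
qed

lemma subspace_diag_dom: "ell2.subspace (diag_dom U lam)"
  unfolding ell2.subspace_def
  by (auto simp: add_diag_dom scaleC_diag_dom intro: diag_domI[where z = 0])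

lemma ket_in_diag_dom: "ket v \<in> diag_dom U lam"
  by (rule diag_domI[where z = "scaleC (lam v) (ket v)"]) auto

text \<open>Multiplication by \<open>lam\<close> is closed because coordinates are continuous: the
  coordinates of the two limits still satisfy the defining equation.\<close>

lemma diag_map_closed:
  assumes X: "\<And>n. X n \<in> diag_dom U lam"
    and lim: "X \<longlonglongrightarrow> x" "(\<lambda>n. diag_map U lam (X n)) \<longlonglongrightarrow> z"
  shows "x \<in> diag_dom U lam" "diag_map U lam x = z"
proof -
  have eq: "lam v * coord x v = coord z v" if "v \<in> U" for v
  proof (rule LIMSEQ_unique)
    have "(\<lambda>n. lam v * coord (X n) v) \<longlonglongrightarrow> lam v * coord x v"
      by (intro tendsto_intros lim)
    then show "(\<lambda>n. coord (diag_map U lam (X n)) v) \<longlonglongrightarrow> lam v * coord x v"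
      using that X by (simp add: coord_diag_map)
    show "(\<lambda>n. coord (diag_map U lam (X n)) v) \<longlonglongrightarrow> coord z v"
      by (intro tendsto_intros lim)
  qed
  show "x \<in> diag_dom U lam" by (rule diag_domI[OF eq])
  have "z \<in> ell2_on U"
    using closed_ell2_on lim(2) diag_map_in_ell2_on[OF X]
    by (metis closed_sequentially)
  then show "diag_map U lam x = z" by (intro diag_map_eqI eq)
qed

section \<open>The compatibility conditions\<close>

text \<open>A point \<open>\<mu>\<close> of \<open>Gamma_set U lam\<close> is none of the \<open>lam v\<close>, and
  \<open>\<bar>lam v - \<mu>\<bar>\<^sup>2 \<le> 2 (1 + \<bar>\<mu>\<bar>\<^sup>2) (\<bar>lam v\<bar>\<^sup>2 + 1)\<close>; so the terms in the second condition are
  dominated by those in the first.\<close>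

lemma compat_I_imp_compat_II:
  assumes "compat_I U lam g"
  shows "compat_II U lam g"
proof -
  obtain \<mu> where \<mu>: "\<mu> \<in> Gamma_set U lam"
    and summ: "(\<lambda>v. (cmod (g v))\<^sup>2 / (cmod (lam v - \<mu>))\<^sup>2) summable_on U"
    using assms unfolding compat_I_def by auto
  let ?C = "2 * (1 + (cmod \<mu>)\<^sup>2)"
  show ?thesis
    unfolding compat_II_def
  proof (rule summable_on_comparison_test)
    show "(\<lambda>v. ?C * ((cmod (g v))\<^sup>2 / (cmod (lam v - \<mu>))\<^sup>2)) summable_on U"
      by (intro summable_on_cmult_right summ)
    fix v assume v: "v \<in> U"
    have "0 < (INF v\<in>U. ereal (cmod (\<mu> - lam v)))"
      using \<mu> by (simp add: Gamma_set_def)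
    also have "\<dots> \<le> ereal (cmod (\<mu> - lam v))" using v by (rule INF_lower)
    finally have pos: "0 < (cmod (lam v - \<mu>))\<^sup>2" by (auto simp: norm_minus_commute)
    have "(cmod (lam v - \<mu>))\<^sup>2 \<le> (cmod (lam v) + cmod \<mu>)\<^sup>2"
      by (intro power_mono norm_triangle_ineq4) auto
    also have "\<dots> \<le> 2 * (cmod (lam v))\<^sup>2 + 2 * (cmod \<mu>)\<^sup>2"
      using zero_le_power2[of "cmod (lam v) - cmod \<mu>"]
      by (simp add: power2_eq_square algebra_simps)
    also have "\<dots> \<le> ?C * ((cmod (lam v))\<^sup>2 + 1)"
      by (simp add: algebra_simps)
    finally have "(cmod (g v))\<^sup>2 * (cmod (lam v - \<mu>))\<^sup>2
        \<le> (cmod (g v))\<^sup>2 * (?C * ((cmod (lam v))\<^sup>2 + 1))"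
      by (rule mult_left_mono) simp
    moreover have "0 < (cmod (lam v))\<^sup>2 + 1" by (simp add: add_nonneg_pos)
    ultimately show "(cmod (g v))\<^sup>2 / ((cmod (lam v))\<^sup>2 + 1)
        \<le> ?C * ((cmod (g v))\<^sup>2 / (cmod (lam v - \<mu>))\<^sup>2)"
      using pos by (simp add: field_simps)
  qed auto
qed

text \<open>Writing \<open>cnj g = cnj p + lam * cnj q\<close> with \<open>p = g / (1 + \<bar>lam\<bar>\<^sup>2)\<close> and
  \<open>q = lam * p\<close> turns the sum against the possibly non-square-summable \<open>g\<close> into two honest
  inner products, one with \<open>h\<close> and one with its image under the diagonal operator. The
  second compatibility condition is what makes \<open>p\<close> and \<open>q\<close> square-summable.\<close>

lemma compat_II_functional:
  assumes "compat_II U lam g"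
  obtains p q where
    "\<And>x. x \<in> diag_dom U lam \<Longrightarrow> (\<lambda>v. coord x v * cnj (g v)) summable_on U"
    "\<And>x. x \<in> diag_dom U lam \<Longrightarrow>
       (\<Sum>\<^sub>\<infinity>v\<in>U. coord x v * cnj (g v)) = cinner x p + cinner (diag_map U lam x) q"
proof -
  define m where "m v = 1 + (cmod (lam v))\<^sup>2" for v
  have m: "m v \<ge> 1" for v by (simp add: m_def)
  have lam_m: "(cmod (lam v))\<^sup>2 \<le> m v" for v by (simp add: m_def)
  have summ: "(\<lambda>v. (cmod (g v))\<^sup>2 / m v) summable_on U"
    using assms unfolding compat_II_def m_def by (simp add: add.commute)
  have sq: "(\<lambda>v. (cmod (c v * g v / of_real (m v)))\<^sup>2) summable_on U"
    if c: "\<And>v. (cmod (c v))\<^sup>2 \<le> m v" for c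
  proof (rule summable_on_comparison_test[OF summ])
    fix v
    have "(cmod (c v * g v / of_real (m v)))\<^sup>2 = (cmod (c v))\<^sup>2 * ((cmod (g v))\<^sup>2 / (m v)\<^sup>2)"
      by (simp add: norm_mult norm_divide power_mult_distrib power_divide)
    also have "\<dots> \<le> m v * ((cmod (g v))\<^sup>2 / (m v)\<^sup>2)"
      by (intro mult_right_mono c) auto
    also have "\<dots> = (cmod (g v))\<^sup>2 / m v"
      using m[of v] by (simp add: power2_eq_square)
    finally show "(cmod (c v * g v / of_real (m v)))\<^sup>2 \<le> (cmod (g v))\<^sup>2 / m v" .
  qed auto
  define p where "p = Abs_ell2 (\<lambda>v. if v \<in> U then 1 * g v / of_real (m v) else 0)"
  define q where "q = Abs_ell2 (\<lambda>v. if v \<in> U then lam v * g v / of_real (m v) else 0)"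
  have p: "coord p v = (if v \<in> U then g v / of_real (m v) else 0)" for v
    unfolding p_def using m by (subst coord_Abs_ell2[OF sq]) auto
  have q: "coord q v = (if v \<in> U then lam v * g v / of_real (m v) else 0)" for v
    unfolding q_def using lam_m by (subst coord_Abs_ell2[OF sq]) auto
  have split: "coord x v * cnj (coord p v) + coord (diag_map U lam x) v * cnj (coord q v)
      = (if v \<in> U then coord x v * cnj (g v) else 0)" if "x \<in> diag_dom U lam" for x v
  proof -
    have "complex_of_real (m v) \<noteq> 0" using m[of v] by auto
    moreover have "complex_of_real (m v) = 1 + lam v * cnj (lam v)"
      by (simp add: m_def complex_norm_square del: of_real_power)
    ultimately show ?thesis
      using that by (simp add: p q coord_diag_map divide_simps) (simp add: algebra_simps)
  qed
  have "(\<lambda>v. coord x v * cnj (g v)) summable_on U"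
    and "(\<Sum>\<^sub>\<infinity>v\<in>U. coord x v * cnj (g v)) = cinner x p + cinner (diag_map U lam x) q"
    if x: "x \<in> diag_dom U lam" for x
  proof -
    have "(\<lambda>v. coord x v * cnj (coord p v) + coord (diag_map U lam x) v * cnj (coord q v))
        summable_on UNIV"
      by (intro summable_on_add product_summable_coord)
    then have "(\<lambda>v. if v \<in> U then coord x v * cnj (g v) else 0) summable_on UNIV"
      by (simp add: split[OF x])
    then show "(\<lambda>v. coord x v * cnj (g v)) summable_on U"
      by (subst summable_on_cong_neutral[where T = UNIV
            and g = "\<lambda>v. if v \<in> U then coord x v * cnj (g v) else 0"]) auto
    have "cinner x p + cinner (diag_map U lam x) q
        = (\<Sum>\<^sub>\<infinity>v. coord x v * cnj (coord p v) + coord (diag_map U lam x) v * cnj (coord q v))"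
      unfolding cinner.rep_eq
      by (rule infsum_add[symmetric, OF product_summable_coord product_summable_coord])
    also have "\<dots> = (\<Sum>\<^sub>\<infinity>v\<in>U. coord x v * cnj (g v))"
      unfolding split[OF x] by (rule infsum_cong_neutral) auto
    finally show "(\<Sum>\<^sub>\<infinity>v\<in>U. coord x v * cnj (g v))
        = cinner x p + cinner (diag_map U lam x) q" by simp
  qed
  then show thesis by (rule that)
qed

section \<open>Relatively bounded perturbations of the diagonal part\<close>

text \<open>The analytic core: \<open>T\<close> is the diagonal part plus a correction that is continuous in the
  pair (vector, image under the diagonal part), and whose component in \<open>\<ell>\<^sup>2(U)\<close> depends
  continuously on the vector alone. This second property, which comes from \<open>f\<close> vanishing
  on \<open>U\<close>, recovers the limit of the diagonal parts from the limit of the values of \<open>T\<close>.\<close>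

lemma relatively_bounded_closed_core:
  fixes V U :: "'v set" and T :: "'v operator"
    and f w e p q :: "'v ell2" and lam :: "'v \<Rightarrow> complex"
  assumes UV: "U \<subseteq> V" and f: "f \<in> ell2_on (V - U)" and e: "e \<in> ell2_on V"
    and dom: "op_dom T = ell2_on V \<inter> diag_dom U lam"
    and app: "\<And>x. x \<in> op_dom T \<Longrightarrow> op_app T x = diag_map U lam x +
       (scaleC (cinner x p + cinner (diag_map U lam x) q) f
        + scaleC (cinner (x - restrict_ell2 U x) w) e)"
  shows "linear_operator_in (ell2_on V) T" "closed_operator T"
    "is_core (ell2_on V) (ell2.span (ket ` V)) T"
proof -
  let ?L = "diag_map U lam"
  have sub: "ell2.subspace (op_dom T)"
    unfolding dom by (intro ell2.subspace_inter subspace_ell2_on subspace_diag_dom)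
  have L_dom: "x \<in> diag_dom U lam" if "x \<in> op_dom T" for x
    using that dom by auto
  show "linear_operator_in (ell2_on V) T"
    unfolding linear_operator_in_def
  proof (intro conjI ballI allI)
    show "op_dom T \<subseteq> ell2_on V" using dom by auto
    show "op_app T ` op_dom T \<subseteq> ell2_on V"
    proof
      fix y assume "y \<in> op_app T ` op_dom T"
      then obtain x where x: "x \<in> op_dom T" "y = op_app T x" by auto
      have "?L x \<in> ell2_on V" "f \<in> ell2_on V"
        using diag_map_in_ell2_on[OF L_dom[OF x(1)]] f UV by (auto simp: ell2_on_def)
      then show "y \<in> ell2_on V"
        unfolding x(2) app[OF x(1)]
        by (intro ell2.subspace_add ell2.subspace_scale subspace_ell2_on e)
    qed
  next
    fix x y assume x: "x \<in> op_dom T" and y: "y \<in> op_dom T"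
    have "x + y \<in> op_dom T" using x y sub ell2.subspace_add by blast
    then show "op_app T (x + y) = op_app T x + op_app T y"
      by (intro ell2_eqI)
         (simp add: app x y diag_map_add L_dom cinner_add cinner_diff restrict_add algebra_simps)
  next
    fix c x assume x: "x \<in> op_dom T"
    have "scaleC c x \<in> op_dom T" using x sub ell2.subspace_scale by blast
    then show "op_app T (scaleC c x) = scaleC c (op_app T x)"
      by (intro ell2_eqI)
         (simp add: app x diag_map_scaleC L_dom cinner_scaleC cinner_diff restrict_scaleC
           algebra_simps)
  qed (rule sub)

  have app_tendsto: "((\<lambda>n. op_app T (X n)) \<longlongrightarrow> op_app T x) F"
    if X: "\<And>n. X n \<in> op_dom T" and x: "x \<in> op_dom T"
      and lim: "(X \<longlongrightarrow> x) F" "((\<lambda>n. ?L (X n)) \<longlongrightarrow> ?L x) F"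
    for X :: "'i \<Rightarrow> 'v ell2" and x F
    unfolding app[OF X] app[OF x] by (intro tendsto_intros lim)

  show closed: "closed_operator T"
    unfolding closed_operator_def closed_sequential_limits
  proof (intro allI impI, elim conjE)
    fix Z and z :: "'v ell2 \<times> 'v ell2"
    assume Z: "\<forall>n. Z n \<in> op_graph T" and lim: "Z \<longlonglongrightarrow> z"
    define X where "X n = fst (Z n)" for n
    have X: "X n \<in> op_dom T" and snd_Z: "snd (Z n) = op_app T (X n)" for n
      using Z[rule_format, of n] by (auto simp: op_graph_def X_def)
    have limX: "X \<longlonglongrightarrow> fst z" unfolding X_def by (intro tendsto_intros lim)
    have limT: "(\<lambda>n. op_app T (X n)) \<longlonglongrightarrow> snd z"
      unfolding snd_Z[symmetric] by (intro tendsto_intros lim)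
    let ?N = "\<lambda>x. scaleC (cinner (x - restrict_ell2 U x) w) e"
    \<comment> \<open>Projecting onto \<open>\<ell>\<^sup>2(U)\<close> removes the multiple of \<open>f\<close>, whose coefficient is
      not yet known to converge.\<close>
    have L_eq: "?L (X n) = restrict_ell2 U (op_app T (X n) - ?N (X n))" for n
      using f diag_map_in_ell2_on[OF L_dom[OF X[of n]]]
      by (intro ell2_eqI) (auto simp: app[OF X] ell2_on_def)
    have limL: "(\<lambda>n. ?L (X n)) \<longlonglongrightarrow> restrict_ell2 U (snd z - ?N (fst z))"
      unfolding L_eq by (intro tendsto_intros limX limT)
    note L = diag_map_closed[OF L_dom[OF X] limX limL]
    have "fst z \<in> ell2_on V"
      using closed_sequentially[OF closed_ell2_on _ limX] X dom by blast
    with L(1) have x: "fst z \<in> op_dom T" by (simp add: dom)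
    have "(\<lambda>n. op_app T (X n)) \<longlonglongrightarrow> op_app T (fst z)"
      using limL L(2) by (intro app_tendsto X x limX) auto
    then have "snd z = op_app T (fst z)"
      by (rule LIMSEQ_unique[OF limT])
    with x show "z \<in> op_graph T" by (cases z) (auto simp: op_graph_def)
  qed

  have span_dom: "ell2.span (ket ` V) \<subseteq> op_dom T"
    by (rule ell2.span_minimal[OF _ sub]) (auto simp: dom ket_in_ell2_on ket_in_diag_dom)
  have "op_graph T \<subseteq> closure (op_graph (op_restrict T (ell2.span (ket ` V))))"
    (is "_ \<subseteq> closure ?G")
  proof
    fix z assume "z \<in> op_graph T"
    then obtain x where x: "x \<in> op_dom T" and z: "z = (x, op_app T x)"
      by (auto simp: op_graph_def)
    have trunc_dom: "restrict_ell2 F x \<in> op_dom T" for F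
      using x by (auto simp: dom restrict_diag_dom) (simp add: ell2_on_def)
    have "((\<lambda>F. op_app T (restrict_ell2 F x)) \<longlongrightarrow> op_app T x) (finite_subsets_at_top UNIV)"
      using x L_dom by (intro app_tendsto trunc_dom tendsto_truncation)
        (simp_all add: diag_map_restrict tendsto_truncation)
    then have lim: "((\<lambda>F. (restrict_ell2 F x, op_app T (restrict_ell2 F x))) \<longlongrightarrow> z)
        (finite_subsets_at_top UNIV)"
      unfolding z by (intro tendsto_Pair tendsto_truncation)
    show "z \<in> closure ?G"
    proof (rule Lim_in_closed_set[OF closed_closure _ _ lim])
      have "(restrict_ell2 F x, op_app T (restrict_ell2 F x)) \<in> ?G" if "finite F" for F
        using trunc_dom truncation_in_span_ket[of x V F] that x
        by (auto simp: op_graph_def op_restrict_def dom)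
      then show "\<forall>\<^sub>F F in finite_subsets_at_top UNIV.
          (restrict_ell2 F x, op_app T (restrict_ell2 F x)) \<in> closure ?G"
        using closure_subset by (intro eventually_finite_subsets_at_top_weakI) blast
    qed simp
  qed
  then have "closure (op_graph T) \<subseteq> closure ?G" by (intro closure_minimal closed_closure)
  moreover have "closure ?G \<subseteq> closure (op_graph T)"
    by (rule closure_mono) (auto simp: op_graph_def op_restrict_def)
  moreover have "closable_operator T"
    using closed unfolding closed_operator_def closable_operator_def
    by (simp add: single_valued_def op_graph_def)
  ultimately show "is_core (ell2_on V) (ell2.span (ket ` V)) T"
    unfolding is_core_def using span_dom closure_span_ket ell2.subspace_span by blast
qed

section \<open>Rank one extensions\<close>

lemma join_U_subset:
  assumes "E \<subseteq> V \<times> V" "u \<in> V"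
  shows "join_U V E u b \<subseteq> V"
proof -
  have "Des E u \<subseteq> V"
  proof
    fix v assume "v \<in> Des E u"
    then have "(u, v) \<in> E\<^sup>*" by (simp add: Des_def)
    then show "v \<in> V" using assms by (cases rule: rtranclE) auto
  qed
  moreover have "Asc E u \<subseteq> V"
  proof
    fix w assume "w \<in> Asc E u"
    then obtain n where "n \<ge> 1" "(w, u) \<in> E ^^ n" by (auto simp: Asc_def)
    then have "(w, u) \<in> E\<^sup>+" unfolding trancl_power by (metis less_le_trans zero_less_one)
    then show "w \<in> V" using assms by (cases rule: converse_tranclE) auto
  qed
  ultimately show ?thesis by (auto simp: join_U_def)
qed

lemma orthogonal_sum_diag_dom:
  assumes "U \<subseteq> V"
  shows "{h + k | h k. h \<in> ell2_on U \<inter> diag_dom U lam \<and> k \<in> ell2_on (V - U)}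
    = ell2_on V \<inter> diag_dom U lam" (is "?S = _")
proof (intro set_eqI iffI)
  fix x assume "x \<in> ?S"
  then obtain h k where x: "x = h + k" and h: "h \<in> ell2_on U" "h \<in> diag_dom U lam"
    and k: "k \<in> ell2_on (V - U)" by auto
  have "k \<in> diag_dom U lam" using k by (intro diag_domI[where z = 0]) (auto simp: ell2_on_def)
  then have "x \<in> diag_dom U lam" unfolding x by (intro add_diag_dom h)
  moreover have "x \<in> ell2_on V" using h k assms by (auto simp: ell2_on_def x)
  ultimately show "x \<in> ell2_on V \<inter> diag_dom U lam" by simp
next
  fix x assume x: "x \<in> ell2_on V \<inter> diag_dom U lam"
  let ?h = "restrict_ell2 U x"
  have "?h \<in> ell2_on U \<inter> diag_dom U lam"
    using x by (auto simp: restrict_diag_dom) (simp add: ell2_on_def)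
  moreover have "x - ?h \<in> ell2_on (V - U)" using x by (auto simp: ell2_on_def)
  moreover have "x = ?h + (x - ?h)" by simp
  ultimately show "x \<in> ?S" by blast
qed

theorem theorem4p11:
  fixes V :: "'v set" and E :: "('v \<times> 'v) set" and r u b :: 'v
    and lam g :: "'v \<Rightarrow> complex" and f :: "'v ell2"
  assumes "rooted_directed_tree V E r"
    and "countable V" and "infinite V"
    and "u \<in> V" and "b \<in> V"
    and "f \<in> ell2_on V \<ominus> ell2_on (join_U V E u b)" and "f \<noteq> 0"
    and "compat_I (join_U V E u b) lam g \<or> compat_II (join_U V E u b) lam g"
  shows "linear_operator_in (ell2_on V) (rank_one_ext V E u b lam f g) \<and>
         closed_operator (rank_one_ext V E u b lam f g) \<and>
         op_dom (rank_one_ext V E u b lam f g) =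
           {h + k | h k. h \<in> op_dom (diag_op (join_U V E u b) lam) \<and>
                         k \<in> ell2_on V \<ominus> ell2_on (join_U V E u b)} \<and>
         is_core (ell2_on V) (ell2.span (ket ` V)) (rank_one_ext V E u b lam f g)"
proof -
  let ?U = "join_U V E u b" and ?W = "rank_one_ext V E u b lam f g"
  have UV: "?U \<subseteq> V"
    using assms(1,4) by (intro join_U_subset) (auto simp: rooted_directed_tree_def directed_tree_def)
  have "compat_II ?U lam g" using assms(8) compat_I_imp_compat_II by blast
  then obtain p q where
    summ: "\<And>x. x \<in> diag_dom ?U lam \<Longrightarrow> (\<lambda>v. coord x v * cnj (g v)) summable_on ?U"
    and pq: "\<And>x. x \<in> diag_dom ?U lam \<Longrightarrow>
       (\<Sum>\<^sub>\<infinity>v\<in>?U. coord x v * cnj (g v)) = cinner x p + cinner (diag_map ?U lam x) q"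
    by (rule compat_II_functional) blast
  have dom_D: "op_dom (diag_op ?U lam) = ell2_on ?U \<inter> diag_dom ?U lam"
    by (auto simp: diag_op_def diag_dom_def)
  have "op_dom (diag_op ?U lam) \<inter> op_dom (oslash_op ?U f g) = op_dom (diag_op ?U lam)"
    using summ by (auto simp: dom_D oslash_op_def)
  then have dom: "op_dom ?W = {h + k | h k. h \<in> op_dom (diag_op ?U lam) \<and>
      k \<in> ell2_on V \<ominus> ell2_on ?U}"
    unfolding rank_one_ext_def Let_def by (simp only: operator.simps)
  have dom': "op_dom ?W = ell2_on V \<inter> diag_dom ?U lam"
    unfolding dom dom_D ell2_on_ominus by (rule orthogonal_sum_diag_dom[OF UV])
  have app: "op_app ?W x = diag_map ?U lam x +
       (scaleC (cinner x p + cinner (diag_map ?U lam x) q) f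
        + scaleC (cinner (x - restrict_ell2 ?U x) (e_weight lam (join_A E u b))) (ket u))"
    if "x \<in> op_dom ?W" for x
  proof -
    have x: "x \<in> diag_dom ?U lam" using that dom' by auto
    have "op_app (diag_op ?U lam) (restrict_ell2 ?U x) = diag_map ?U lam x"
      unfolding diag_op_def diag_map_def by (simp cong: if_cong)
    moreover have "op_app (oslash_op ?U f g) (restrict_ell2 ?U x)
        = scaleC (cinner x p + cinner (diag_map ?U lam x) q) f"
      unfolding oslash_op_def pq[OF x, symmetric] by (simp cong: infsum_cong)
    ultimately show ?thesis
      by (simp add: rank_one_ext_def Let_def join_N_def rank_one_def)
  qed
  have f: "f \<in> ell2_on (V - ?U)" using assms(6) by (simp add: ell2_on_ominus)
  have e: "ket u \<in> ell2_on V" using assms(4) by (rule ket_in_ell2_on)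
  note * = relatively_bounded_closed_core[OF UV f e dom' app]
  show ?thesis using * dom by blast
qed

end
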